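(* Let $\alpha=\sum_{i=1}^n a_i\delta_{x_i}$ and $\beta=\sum_{j=1}^m b_j\delta_{y_j}$ be two positive discrete measures on $\mathbb{R}^d$. Given a shift direction $\eta\in\mathbb{R}^d$ and a shift size $s>0$, denote the shift of $\alpha$ by $$\alpha_s=\sum_{i=1}^n a_i\,\delta_{x_i+s\eta}.$$ Then the function $s\mapsto J(s):=J(\alpha_s;\beta)$ is convex with respect to $s$ (on $s>0$), where $J(\cdot\,;\cdot)$ is the objective function defined in the context.
   Context: A positive discrete measure on $\mathbb{R}^d$ ($d\ge 1$) is a measure $\alpha=\sum_{i=1}^n a_i\delta_{x_i}$ with $x_i\in\mathbb{R}^d$ and $a=(a_1,\dots,a_n)\in\mathbb{R}_+^n$ (nonnegative entries), $\|a\|_1=\sum_i a_i>0$. Its normalization is the probability measure $\hat\alpha=\sum_{i=1}^n \hat a_i\delta_{x_i}$ with $\hat a_i=a_i/\|a\|_1$; similarly for $\beta=\sum_{j=1}^m b_j\delta_{y_j}$, $\hat b_j=b_j/\|b\|_1$. For discrete probability measures $\mu=\sum_{i=1}^n p_i\delta_{x_i}$ and $\nu=\sum_{j=1}^m q_j\delta_{y_j}$ on $\mathbb{R}^d$, the squared 2-Wasserstein distance is $$W_2^2(\mu,\nu)=\min\Big\{\sum_{i,j}|x_i-y_j|^2P_{i,j}\ :\ P\in\mathbb{R}_+^{n\times m},\ \sum_j P_{i,j}=p_i\ \forall i,\ \sum_i P_{i,j}=q_j\ \forall j\Big\},$$ with $|\cdot|$ the Euclidean norm. The objective function is $$J(\alpha;\beta)=W_2^2(\hat\alpha,\hat\beta)+\big(\|a\|_1-\|b\|_1\big)^2.$$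 *)

theory Defs
  imports "HOL-Analysis.Analysis"
begin

text \<open>
  A finitely supported measure \<open>\<Sum>i=1..n. a i \<delta>(x i)\<close> is given by the number of atoms \<open>n\<close>, the
  weights \<open>a\<close> and the locations \<open>x\<close>.  Only indices in \<open>{1..n}\<close> are meaningful, and the locations
  need not be distinct.
\<close>

record 'v discrete_measure =
  natoms :: nat
  weight :: "nat \<Rightarrow> real"
  atom :: "nat \<Rightarrow> 'v"

definition total_mass :: "'v discrete_measure \<Rightarrow> real" where
  "total_mass \<alpha> = (\<Sum>i=1..natoms \<alpha>. \<bar>weight \<alpha> i\<bar>)"

definition positive_discrete :: "'v discrete_measure \<Rightarrow> bool" where
  "positive_discrete \<alpha> \<longleftrightarrow> (\<forall>i\<in>{1..natoms \<alpha>}. 0 \<le> weight \<alpha> i) \<and> 0 < total_mass \<alpha>"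

definition normalized :: "'v discrete_measure \<Rightarrow> 'v discrete_measure" where
  "normalized \<alpha> = \<alpha>\<lparr>weight := \<lambda>i. weight \<alpha> i / total_mass \<alpha>\<rparr>"

definition shift :: "real \<Rightarrow> 'v::euclidean_space \<Rightarrow> 'v discrete_measure \<Rightarrow> 'v discrete_measure" where
  "shift s \<eta> \<alpha> = \<alpha>\<lparr>atom := \<lambda>i. atom \<alpha> i + s *\<^sub>R \<eta>\<rparr>"

definition transport_plans ::
  "'v discrete_measure \<Rightarrow> 'v discrete_measure \<Rightarrow> (nat \<Rightarrow> nat \<Rightarrow> real) set" where
  "transport_plans \<mu> \<nu> =
     {P. (\<forall>i\<in>{1..natoms \<mu>}. \<forall>j\<in>{1..natoms \<nu>}. 0 \<le> P i j)
       \<and> (\<forall>i\<in>{1..natoms \<mu>}. (\<Sum>j=1..natoms \<nu>. P i j) = weight \<mu> i)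
       \<and> (\<forall>j\<in>{1..natoms \<nu>}. (\<Sum>i=1..natoms \<mu>. P i j) = weight \<nu> j)}"

definition transport_cost ::
  "'v::euclidean_space discrete_measure \<Rightarrow> 'v discrete_measure \<Rightarrow> (nat \<Rightarrow> nat \<Rightarrow> real) \<Rightarrow> real" where
  "transport_cost \<mu> \<nu> P =
     (\<Sum>i=1..natoms \<mu>. \<Sum>j=1..natoms \<nu>. (norm (atom \<mu> i - atom \<nu> j))\<^sup>2 * P i j)"

text \<open>
  On the reals, \<open>LEAST\<close> is the minimum whenever it is attained; that it is attained for any two
  positive discrete measures of equal mass is \<open>wasserstein2_sq_attained\<close> below.
\<close>

definition wasserstein2_sq ::
  "'v::euclidean_space discrete_measure \<Rightarrow> 'v discrete_measure \<Rightarrow> real" where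
  "wasserstein2_sq \<mu> \<nu> = (LEAST c. c \<in> transport_cost \<mu> \<nu> ` transport_plans \<mu> \<nu>)"

definition objective ::
  "'v::euclidean_space discrete_measure \<Rightarrow> 'v discrete_measure \<Rightarrow> real" where
  "objective \<alpha> \<beta> =
     wasserstein2_sq (normalized \<alpha>) (normalized \<beta>) + (total_mass \<alpha> - total_mass \<beta>)\<^sup>2"

lemma wasserstein2_sq_attained:
  assumes "positive_discrete \<mu>" and "positive_discrete \<nu>" and eq: "total_mass \<mu> = total_mass \<nu>"
  shows "\<exists>P\<in>transport_plans \<mu> \<nu>. transport_cost \<mu> \<nu> P = wasserstein2_sq \<mu> \<nu>"
    and "\<And>P. P \<in> transport_plans \<mu> \<nu> \<Longrightarrow> wasserstein2_sq \<mu> \<nu> \<le> transport_cost \<mu> \<nu> P"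
proof -
  let ?I = "{1..natoms \<mu>}" and ?J = "{1..natoms \<nu>}"
  define M where "M = total_mass \<mu>"
  have pos: "\<And>i. i \<in> ?I \<Longrightarrow> 0 \<le> weight \<mu> i" "\<And>j. j \<in> ?J \<Longrightarrow> 0 \<le> weight \<nu> j" and M0: "0 < M"
    using assms unfolding positive_discrete_def M_def by auto
  have Mmu: "(\<Sum>i\<in>?I. weight \<mu> i) = M" and Mnu: "(\<Sum>j\<in>?J. weight \<nu> j) = M"
    using pos eq by (auto simp: M_def total_mass_def intro!: sum.cong)
  define B where "B = PiE UNIV (\<lambda>i::nat. PiE UNIV (\<lambda>j::nat. {0..M}))"
  have "compact (PiE UNIV (\<lambda>j::nat. {0..M}))"
    using compactin_PiE[of "\<lambda>_. euclidean" UNIV "\<lambda>j::nat. {0..M}"]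
    by (simp add: euclidean_product_topology)
  then have cB: "compact B"
    using compactin_PiE[of "\<lambda>_. euclidean" UNIV "\<lambda>i::nat. PiE UNIV (\<lambda>j::nat. {0..M})"]
    by (simp add: euclidean_product_topology B_def)
  have cont: "continuous_on S (\<lambda>P. P i j)" for S :: "(nat \<Rightarrow> nat \<Rightarrow> real) set" and i j
    by (rule continuous_on_product_then_coordinatewise[of S "\<lambda>P. P i" j,
          OF continuous_on_product_then_coordinatewise[of S "\<lambda>P. P" i, OF continuous_on_id]])
  have "closed {P. (\<forall>i\<in>?I. \<forall>j\<in>?J. 0 \<le> P i j) \<and> (\<forall>i\<in>?I. (\<Sum>j\<in>?J. P i j) = weight \<mu> i)
       \<and> (\<forall>j\<in>?J. (\<Sum>i\<in>?I. P i j) = weight \<nu> j)}"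
    unfolding Ball_def
    by (intro closed_Collect_conj closed_Collect_all closed_Collect_imp closed_Collect_le
          closed_Collect_eq open_Collect_const continuous_on_const continuous_on_sum cont)
  then have cl: "closed (transport_plans \<mu> \<nu>)" unfolding transport_plans_def .
  have cK: "compact (B \<inter> transport_plans \<mu> \<nu>)"
    using cB cl by (rule compact_Int_closed)
  define P0 where "P0 = (\<lambda>i j. if i \<in> ?I \<and> j \<in> ?J then weight \<mu> i * weight \<nu> j / M else 0)"
  have "P0 \<in> transport_plans \<mu> \<nu>"
    unfolding transport_plans_def P0_def using pos M0 Mmu Mnu
    by (auto simp: sum_distrib_left[symmetric] sum_distrib_right[symmetric] sum_divide_distrib[symmetric])
  define cut where "cut = (\<lambda>P::nat\<Rightarrow>nat\<Rightarrow>real. \<lambda>i j. if i \<in> ?I \<and> j \<in> ?J then P i j else 0)"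
  have cut: "cut P \<in> B \<inter> transport_plans \<mu> \<nu>" "transport_cost \<mu> \<nu> (cut P) = transport_cost \<mu> \<nu> P"
    if P: "P \<in> transport_plans \<mu> \<nu>" for P
  proof -
    have "P i j \<le> M" if "i \<in> ?I" "j \<in> ?J" for i j
    proof -
      have "P i j \<le> (\<Sum>j\<in>?J. P i j)"
        using P that by (intro member_le_sum) (auto simp: transport_plans_def)
      also have "\<dots> = weight \<mu> i" using P that by (auto simp: transport_plans_def)
      also have "\<dots> \<le> (\<Sum>i\<in>?I. weight \<mu> i)" using that pos by (intro member_le_sum) auto
      finally show ?thesis using Mmu by simp
    qed
    then have "cut P \<in> B"
      using P M0 by (auto simp: B_def cut_def transport_plans_def)
    moreover have "cut P \<in> transport_plans \<mu> \<nu>"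
      using P by (auto simp: cut_def transport_plans_def)
    ultimately show "cut P \<in> B \<inter> transport_plans \<mu> \<nu>" by simp
    show "transport_cost \<mu> \<nu> (cut P) = transport_cost \<mu> \<nu> P"
      by (auto simp: transport_cost_def cut_def intro!: sum.cong)
  qed
  have "continuous_on (B \<inter> transport_plans \<mu> \<nu>) (transport_cost \<mu> \<nu>)"
    unfolding transport_cost_def
    by (intro continuous_on_sum continuous_on_mult continuous_on_const cont)
  moreover have "B \<inter> transport_plans \<mu> \<nu> \<noteq> {}" using cut \<open>P0 \<in> _\<close> by blast
  ultimately obtain Q where Q: "Q \<in> transport_plans \<mu> \<nu>"
    and Qmin: "\<And>P. P \<in> B \<inter> transport_plans \<mu> \<nu> \<Longrightarrow> transport_cost \<mu> \<nu> Q \<le> transport_cost \<mu> \<nu> P"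
    using continuous_attains_inf[OF cK] by blast
  have min: "transport_cost \<mu> \<nu> Q \<le> transport_cost \<mu> \<nu> P" if "P \<in> transport_plans \<mu> \<nu>" for P
    using Qmin[OF cut(1)[OF that]] cut(2)[OF that] by simp
  have W: "wasserstein2_sq \<mu> \<nu> = transport_cost \<mu> \<nu> Q"
    unfolding wasserstein2_sq_def using Q min by (intro Least_equality) auto
  show "\<exists>P\<in>transport_plans \<mu> \<nu>. transport_cost \<mu> \<nu> P = wasserstein2_sq \<mu> \<nu>"
    using Q W by auto
  show "\<And>P. P \<in> transport_plans \<mu> \<nu> \<Longrightarrow> wasserstein2_sq \<mu> \<nu> \<le> transport_cost \<mu> \<nu> P"
    using W min by simp
qed

end

theory Submission
  imports Defs
begin

text \<open>
  Expanding the square, the cost of a plan \<open>P\<close> after the shift exceeds its cost before by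
  \<open>2 s \<Sum>i,j. P i j \<eta> \<bullet> (x i - y j) + s\<^sup>2 |\<eta>|\<^sup>2 \<Sum>i,j. P i j\<close>, which depends only on the marginals of \<open>P\<close>.
  So the same plans stay optimal, and the objective is a quadratic polynomial in \<open>s\<close> with leading
  coefficient \<open>|\<eta>|\<^sup>2\<close>.
\<close>

lemma shift_simps [simp]:
  "natoms (shift s \<eta> \<mu>) = natoms \<mu>"
  "weight (shift s \<eta> \<mu>) = weight \<mu>"
  "atom (shift s \<eta> \<mu>) i = atom \<mu> i + s *\<^sub>R \<eta>"
  by (simp_all add: shift_def)

lemma total_mass_shift [simp]: "total_mass (shift s \<eta> \<mu>) = total_mass \<mu>"
  by (simp add: total_mass_def)

lemma transport_plans_shift [simp]: "transport_plans (shift s \<eta> \<mu>) \<nu> = transport_plans \<mu> \<nu>"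
  by (simp add: transport_plans_def)

text \<open>Normalizing changes only the weights and shifting only the atoms, so the two commute.
  This brings the shift to the outside, where \<open>wasserstein2_sq_shift\<close> applies.\<close>

lemma normalized_shift: "normalized (shift s \<eta> \<mu>) = shift s \<eta> (normalized \<mu>)"
  by (simp add: normalized_def shift_def total_mass_def)

lemma total_mass_normalized:
  assumes "positive_discrete \<mu>"
  shows "total_mass (normalized \<mu>) = 1"
proof -
  have "0 < total_mass \<mu>"
    using assms by (simp add: positive_discrete_def)
  moreover from this have "total_mass (normalized \<mu>) = total_mass \<mu> / total_mass \<mu>"
    \<comment> \<open>Only this instance is unfolded, so that the divisor
      \<open>total_mass \<mu>\<close> stays a common factor and leaves the sum.\<close>
    unfolding total_mass_def[of "normalized \<mu>"]
    by (simp add: normalized_def flip: sum_divide_distrib) (simp add: total_mass_def)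
  ultimately show ?thesis by simp
qed

lemma positive_discrete_normalized:
  assumes "positive_discrete \<mu>"
  shows "positive_discrete (normalized \<mu>)"
proof -
  have "0 < total_mass (normalized \<mu>)"
    using total_mass_normalized[OF assms] by simp
  with assms show ?thesis
    by (auto simp: positive_discrete_def normalized_def)
qed

text \<open>Each term added by expanding the square depends on at most one of the indices
  \<open>i\<close> and \<open>j\<close>, so a row or column sum of \<open>P\<close> evaluates
  it.\<close>

lemma transport_cost_shift:
  assumes P: "P \<in> transport_plans \<mu> \<nu>"
  shows "transport_cost (shift s \<eta> \<mu>) \<nu> P = transport_cost \<mu> \<nu> P
    + s * (2 * ((\<Sum>i=1..natoms \<mu>. (\<eta> \<bullet> atom \<mu> i) * weight \<mu> i)
              - (\<Sum>j=1..natoms \<nu>. (\<eta> \<bullet> atom \<nu> j) * weight \<nu> j)))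
    + s\<^sup>2 * ((norm \<eta>)\<^sup>2 * (\<Sum>i=1..natoms \<mu>. weight \<mu> i))"
proof -
  let ?I = "{1..natoms \<mu>}" and ?J = "{1..natoms \<nu>}"
  have row: "(\<Sum>j\<in>?J. P i j) = weight \<mu> i" if "i \<in> ?I" for i
    using P that by (auto simp: transport_plans_def)
  have col: "(\<Sum>i\<in>?I. P i j) = weight \<nu> j" if "j \<in> ?J" for j
    using P that by (auto simp: transport_plans_def)
  \<comment> \<open>The grouping of the factors, including \<open>1 * p\<close>, prepares the
    patterns \<open>f i * P i j\<close> and \<open>f j * P i j\<close> of \<open>mu\<close> and
    \<open>nu\<close>.\<close>
  have expand: "(norm (x + s *\<^sub>R \<eta> - y))\<^sup>2 * p = (norm (x - y))\<^sup>2 * p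
      + 2 * s * ((\<eta> \<bullet> x) * p) - 2 * s * ((\<eta> \<bullet> y) * p) + s\<^sup>2 * (norm \<eta>)\<^sup>2 * (1 * p)" for x y p
    unfolding power2_norm_eq_inner
    by (simp add: inner_simps inner_commute algebra_simps power2_eq_square)
  have mu: "(\<Sum>i\<in>?I. \<Sum>j\<in>?J. f i * P i j) = (\<Sum>i\<in>?I. f i * weight \<mu> i)" for f
    using row by (simp add: sum_distrib_left[symmetric])
  have nu: "(\<Sum>i\<in>?I. \<Sum>j\<in>?J. f j * P i j) = (\<Sum>j\<in>?J. f j * weight \<nu> j)" for f
    using col by (subst sum.swap) (simp add: sum_distrib_left[symmetric])
  have "transport_cost (shift s \<eta> \<mu>) \<nu> P = transport_cost \<mu> \<nu> P
      + 2 * s * (\<Sum>i\<in>?I. \<Sum>j\<in>?J. (\<eta> \<bullet> atom \<mu> i) * P i j)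
      - 2 * s * (\<Sum>i\<in>?I. \<Sum>j\<in>?J. (\<eta> \<bullet> atom \<nu> j) * P i j)
      + s\<^sup>2 * (norm \<eta>)\<^sup>2 * (\<Sum>i\<in>?I. \<Sum>j\<in>?J. 1 * P i j)"
    unfolding transport_cost_def shift_simps expand sum.distrib sum_subtractf sum_distrib_left ..
  then show ?thesis
    unfolding mu nu by (simp add: algebra_simps)
qed

text \<open>The hypotheses provide an optimal plan, so that \<open>LEAST\<close> is a true minimum
  before the shift; the same plan then attains the minimum after it.\<close>

lemma wasserstein2_sq_shift:
  assumes "positive_discrete \<mu>" "positive_discrete \<nu>" "total_mass \<mu> = total_mass \<nu>"
  shows "wasserstein2_sq (shift s \<eta> \<mu>) \<nu> = wasserstein2_sq \<mu> \<nu>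
    + s * (2 * ((\<Sum>i=1..natoms \<mu>. (\<eta> \<bullet> atom \<mu> i) * weight \<mu> i)
              - (\<Sum>j=1..natoms \<nu>. (\<eta> \<bullet> atom \<nu> j) * weight \<nu> j)))
    + s\<^sup>2 * ((norm \<eta>)\<^sup>2 * (\<Sum>i=1..natoms \<mu>. weight \<mu> i))" (is "_ = _ + ?A + ?B")
proof -
  obtain P where P: "P \<in> transport_plans \<mu> \<nu>" "transport_cost \<mu> \<nu> P = wasserstein2_sq \<mu> \<nu>"
    using wasserstein2_sq_attained(1)[OF assms] by blast
  have "(LEAST c. c \<in> transport_cost (shift s \<eta> \<mu>) \<nu> ` transport_plans \<mu> \<nu>)
      = transport_cost (shift s \<eta> \<mu>) \<nu> P"
  proof (rule Least_equality)
    show "transport_cost (shift s \<eta> \<mu>) \<nu> P \<in> transport_cost (shift s \<eta> \<mu>) \<nu> ` transport_plans \<mu> \<nu>"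
      using P(1) by (rule imageI)
  \<comment> \<open>Minimality carries over: the terms added to the costs of two plans are equal and
    cancel.\<close>
  qed (use P wasserstein2_sq_attained(2)[OF assms] in \<open>auto simp: transport_cost_shift\<close>)
  then show ?thesis
    using P by (simp add: wasserstein2_sq_def[of "shift s \<eta> \<mu>"] transport_cost_shift)
qed

lemma convex_on_quadratic:
  fixes a b c :: real
  assumes "0 \<le> a" "convex S"
  shows "convex_on S (\<lambda>s. c + s * b + s\<^sup>2 * a)"
proof -
  have "convex_on S (\<lambda>s. a * s\<^sup>2)"
    using assms by (intro convex_on_cmul convex_on_subset[OF convex_power2]) auto
  \<comment> \<open>For an affine function the convexity inequality is an equality, as the weights
    sum to 1.\<close>
  moreover have "convex_on S (\<lambda>s. c + s * b)"
    using assms(2) by (auto simp: convex_on_def algebra_simps simp flip: distrib_right)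
  ultimately show ?thesis
    using convex_on_add by (fastforce simp: mult.commute)
qed

theorem proposition2p5:
  fixes \<alpha> \<beta> :: "(real ^ 'd) discrete_measure" and \<eta> :: "real ^ 'd"
  assumes "positive_discrete \<alpha>" and "positive_discrete \<beta>"
  shows "convex_on {0<..} (\<lambda>s. objective (shift s \<eta> \<alpha>) \<beta>)"
proof -
  let ?\<mu> = "normalized \<alpha>" and ?\<nu> = "normalized \<beta>"
  have pos: "positive_discrete ?\<mu>" "positive_discrete ?\<nu>" "total_mass ?\<mu> = total_mass ?\<nu>"
    using assms by (simp_all add: positive_discrete_normalized total_mass_normalized)
  \<comment> \<open>This is the coefficient of \<open>s\<^sup>2\<close>.\<close>
  have "0 \<le> (norm \<eta>)\<^sup>2 * (\<Sum>i=1..natoms ?\<mu>. weight ?\<mu> i)"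
    using pos(1) by (intro mult_nonneg_nonneg sum_nonneg) (auto simp: positive_discrete_def)
  then have "convex_on {0<..} (\<lambda>s. wasserstein2_sq (shift s \<eta> ?\<mu>) ?\<nu>)"
    unfolding wasserstein2_sq_shift[OF pos] by (intro convex_on_quadratic) auto
  \<comment> \<open>The mass term does not vary with \<open>s\<close>, since a shift keeps the
    weights.\<close>
  then show ?thesis
    by (simp add: objective_def normalized_shift convex_on_add convex_on_const)
qed

end
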